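(* Let $f\colon [0,\infty)\to (0,\infty)$ be a non-decreasing function such that $\sum_{n=1}^{\infty} \frac{1}{f(2^n)}<\infty$. Let $0<r<1$ and let $p\geq r$, and define $q=\max\{p, (p-r)/(1-r)\}$. Assume that $\{X_n\}_{n\geq 1}$ is a sequence of (arbitrary) random variables with $\sup_{n\geq 1} \mathbb{E}(|X_n|^q f(|X_n|))<\infty$. Then for all $\varepsilon>0$ we have $$\sum_{n=1}^{\infty} n^{p/r-2}\, \mathbb{P}(M_n>\varepsilon n^{1/r})<\infty.$$
   Context: All random variables are real-valued and those in a sequence $\{X_n\}_{n\geq 1}$ are defined on the same probability space. For $n\geq 1$ let $S_n=\sum_{i=1}^n X_i$ and $M_n=\max_{1\leq i\leq n}|S_i|$. *)

theory Defs
  imports "HOL-Probability.Probability"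
begin

definition partial_sum :: "(nat \<Rightarrow> 'a \<Rightarrow> real) \<Rightarrow> nat \<Rightarrow> 'a \<Rightarrow> real" where
  "partial_sum X n \<omega> = (\<Sum>i=1..n. X i \<omega>)"

text \<open>Only meaningful for \<open>n \<ge> 1\<close>: at \<open>n = 0\<close> this is \<open>Max {}\<close>, which is unspecified.\<close>

definition max_abs_partial_sum :: "(nat \<Rightarrow> 'a \<Rightarrow> real) \<Rightarrow> nat \<Rightarrow> 'a \<Rightarrow> real" where
  "max_abs_partial_sum X n \<omega> = Max ((\<lambda>i. \<bar>partial_sum X i \<omega>\<bar>) ` {1..n})"

end

theory Submission
  imports Defs
begin

text \<open>
  Terms with \<open>\<bar>X\<^sub>i\<bar> \<le> a\<close>, where \<open>a = (\<epsilon>/2) n powr (1/r - 1)\<close>, contribute at most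
  \<open>b = n a = (\<epsilon>/2) n powr (1/r)\<close> to \<open>M\<^sub>n\<close>. Hence on \<open>M\<^sub>n > 2 b\<close> the sum of the large terms exceeds \<open>b\<close>.
  Taking the power \<open>s = min p 1\<close>, which is subadditive, and using
  \<open>\<bar>x\<bar> powr s \<le> a powr (s - q) * \<bar>x\<bar> powr q * f \<bar>x\<bar> / f a\<close> for \<open>\<bar>x\<bar> > a\<close>, Markov's inequality bounds the
  \<open>n\<close>-th term of the series by a constant times \<open>1 / (n * f a)\<close>; the choice of \<open>q\<close> makes all powers of
  \<open>n\<close> cancel except \<open>n powr - 1\<close>. Cauchy condensation then reduces the claim to the convergence of
  \<open>\<Sum>n. 1 / f (2 ^ n)\<close>.
\<close>

text \<open>After division by the total \<open>T\<close> each summand lies in [0,1], where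
  \<open>u \<le> u powr s\<close> because \<open>s \<le> 1\<close>; the quotients
  \<open>y i / T\<close> add up to 1.\<close>

lemma powr_sum_le_sum_powr:
  fixes y :: "'i \<Rightarrow> real"
  assumes "finite I" "\<And>i. i \<in> I \<Longrightarrow> 0 \<le> y i" "0 < s" "s \<le> 1"
  shows "(\<Sum>i\<in>I. y i) powr s \<le> (\<Sum>i\<in>I. y i powr s)"
proof (cases "(\<Sum>i\<in>I. y i) = 0")
  case True
  then show ?thesis by (simp add: sum_nonneg)
next
  case False
  define T where "T = (\<Sum>i\<in>I. y i)"
  have "T > 0"
    using False assms sum_nonneg[of I y] by (simp add: T_def less_le)
  have "y i / T \<le> y i powr s / T powr s" if "i \<in> I" for i
  proof -
    have "0 \<le> y i / T" "y i / T \<le> 1"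
      using that assms \<open>T > 0\<close> member_le_sum[of i I y] by (auto simp: T_def)
    then have "y i / T \<le> (y i / T) powr s"
      using powr_mono'[OF \<open>s \<le> 1\<close>] powr_one[of "y i / T"] by metis
    then show ?thesis
      using \<open>T > 0\<close> assms that by (simp add: powr_divide)
  qed
  then have "(\<Sum>i\<in>I. y i / T) \<le> (\<Sum>i\<in>I. y i powr s / T powr s)"
    by (rule sum_mono)
  moreover have "(\<Sum>i\<in>I. y i / T) = 1"
    using \<open>T > 0\<close> by (simp add: T_def flip: sum_divide_distrib)
  ultimately show ?thesis
    using \<open>T > 0\<close> by (simp add: T_def[symmetric] field_simps flip: sum_divide_distrib)
qed

text \<open>The deterministic core, applied at each sample point: it turns a large sum of absolute
  values into a large sum of weighted moments, which Markov's inequality can handle. Subadditivity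
  uses \<open>s \<le> 1\<close>, and \<open>s \<le> q\<close> makes \<open>u powr (q - s)\<close>
  non-decreasing.\<close>

lemma weighted_sum_ge_of_sum_abs_gt:
  fixes x :: "nat \<Rightarrow> real" and f :: "real \<Rightarrow> real"
  assumes f: "\<And>x. x \<ge> 0 \<Longrightarrow> f x > 0" "mono_on {0..} f"
    and s: "0 < s" "s \<le> 1" "s \<le> q"
    and "a > 0" and gt: "(\<Sum>i=1..n. \<bar>x i\<bar>) > 2 * (real n * a)"
  shows "(real n * a) powr s * a powr (q - s) * f a \<le> (\<Sum>i=1..n. \<bar>x i\<bar> powr q * f \<bar>x i\<bar>)"
proof -
  \<comment> \<open>Small terms are replaced by 0 rather than dropped from the index set; since
    \<open>0 powr s = 0\<close>, they vanish from the sum of powers as well.\<close>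
  define y where "y i = (if \<bar>x i\<bar> > a then \<bar>x i\<bar> else 0)" for i
  have "(\<Sum>i=1..n. \<bar>x i\<bar>) \<le> (\<Sum>i=1..n. y i + a)"
    using \<open>a > 0\<close> by (intro sum_mono) (auto simp: y_def)
  then have "real n * a \<le> (\<Sum>i=1..n. y i)"
    using gt by (simp add: sum.distrib)
  then have "(real n * a) powr s \<le> (\<Sum>i=1..n. y i) powr s"
    using \<open>a > 0\<close> s by (intro powr_mono2) auto
  also have "\<dots> \<le> (\<Sum>i=1..n. y i powr s)"
    using s by (intro powr_sum_le_sum_powr) (auto simp: y_def)
  finally have "(real n * a) powr s * (a powr (q - s) * f a)
      \<le> (\<Sum>i=1..n. y i powr s) * (a powr (q - s) * f a)"
    using f(1)[of a] \<open>a > 0\<close> by (intro mult_right_mono) auto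
  also have "\<dots> = (\<Sum>i=1..n. y i powr s * (a powr (q - s) * f a))"
    by (rule sum_distrib_right)
  also have "\<dots> \<le> (\<Sum>i=1..n. \<bar>x i\<bar> powr q * f \<bar>x i\<bar>)"
  proof (intro sum_mono)
    fix i
    show "y i powr s * (a powr (q - s) * f a) \<le> \<bar>x i\<bar> powr q * f \<bar>x i\<bar>"
    proof (cases "\<bar>x i\<bar> > a")
      case True
      have "a powr (q - s) * f a \<le> \<bar>x i\<bar> powr (q - s) * f \<bar>x i\<bar>"
        using True \<open>a > 0\<close> s f(1)[of a] mono_onD[OF f(2), of a "\<bar>x i\<bar>"]
        by (intro mult_mono powr_mono2) auto
      then have "\<bar>x i\<bar> powr s * (a powr (q - s) * f a)
          \<le> \<bar>x i\<bar> powr s * (\<bar>x i\<bar> powr (q - s) * f \<bar>x i\<bar>)"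
        by (intro mult_left_mono) auto
      also have "\<dots> = \<bar>x i\<bar> powr q * f \<bar>x i\<bar>"
        by (simp flip: powr_add mult.assoc)
      finally show ?thesis
        using True by (simp add: y_def)
    next
      case False
      then show ?thesis
        using f(1)[of "\<bar>x i\<bar>"] by (simp add: y_def)
    qed
  qed
  finally show ?thesis
    by (simp add: mult.assoc)
qed

text \<open>The triangle inequality bounds all the partial sums at once. With
  \<open>n \<ge> 1\<close> the maximum is over a nonempty set.\<close>

lemma max_abs_partial_sum_le_sum_abs:
  assumes "n \<ge> 1"
  shows "max_abs_partial_sum X n \<omega> \<le> (\<Sum>i=1..n. \<bar>X i \<omega>\<bar>)"
proof -
  have "\<bar>partial_sum X j \<omega>\<bar> \<le> (\<Sum>i=1..n. \<bar>X i \<omega>\<bar>)" if "j \<in> {1..n}" for j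
  proof -
    have "\<bar>partial_sum X j \<omega>\<bar> \<le> (\<Sum>i=1..j. \<bar>X i \<omega>\<bar>)"
      unfolding partial_sum_def by (rule sum_abs)
    also have "\<dots> \<le> (\<Sum>i=1..n. \<bar>X i \<omega>\<bar>)"
      using that by (intro sum_mono2) auto
    finally show ?thesis .
  qed
  then show ?thesis
    using assms unfolding max_abs_partial_sum_def by (subst Max_le_iff) auto
qed

text \<open>Each value \<open>g m\<close> is taken on a block of exactly \<open>L\<close> indices,
  so the partial sums stay below \<open>L\<close> times the sum of \<open>g\<close>.\<close>

lemma summable_div_nat:
  fixes g :: "nat \<Rightarrow> real"
  assumes "summable g" "\<And>n. g n \<ge> 0" "L > 0"
  shows "summable (\<lambda>n. g (n div L))"
proof (rule summableI_nonneg_bounded)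
  fix n
  \<comment> \<open>The range is enlarged to a multiple of \<open>L\<close> so that it splits into
    \<open>n\<close> full blocks.\<close>
  have "(\<Sum>i<n. g (i div L)) \<le> (\<Sum>i<n * L. g (i div L))"
    using assms by (intro sum_mono2) auto
  also have "\<dots> = (\<Sum>m<n. \<Sum>i\<in>{m * L..<m * L + L}. g (i div L))"
    by (rule sum.nat_group[symmetric])
  also have "\<dots> = (\<Sum>m<n. \<Sum>i\<in>{m * L..<m * L + L}. g m)"
  proof (intro sum.cong refl)
    fix m i assume "i \<in> {m * L..<m * L + L}"
    then have "i div L = m"
      by (intro div_nat_eqI) (auto simp: algebra_simps)
    then show "g (i div L) = g m" by simp
  qed
  also have "\<dots> = real L * (\<Sum>m<n. g m)"
    by (simp add: sum_distrib_left)
  also have "\<dots> \<le> real L * suminf g"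
    using assms by (intro mult_left_mono sum_le_suminf) auto
  finally show "(\<Sum>i<n. g (i div L)) \<le> real L * suminf g" .
qed (use assms in auto)

text \<open>Up to an index shift, the argument of \<open>f\<close> dominates
  \<open>2 ^ (n div L)\<close>: slowing the index down by \<open>L\<close> makes up for a small
  \<open>\<alpha>\<close>, and the shift makes up for a small \<open>c\<close>.\<close>

lemma summable_inverse_mono_geometric:
  fixes f :: "real \<Rightarrow> real"
  assumes f: "\<And>x. x \<ge> 0 \<Longrightarrow> f x > 0" "mono_on {0..} f"
    and sum: "summable (\<lambda>n. 1 / f (2 ^ n))" and "c > 0" "\<alpha> > 0"
  shows "summable (\<lambda>n. 1 / f (c * (2 ^ n) powr \<alpha>))"
proof -
  \<comment> \<open>Every \<open>L\<close> steps of the index gain at least one factor 2 in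
    \<open>(2 ^ n) powr \<alpha>\<close>.\<close>
  obtain L :: nat where L: "real L * \<alpha> > 1"
    using reals_Archimedean3[OF \<open>\<alpha> > 0\<close>] by blast
  then have "L > 0" by (cases L) auto
  \<comment> \<open>These \<open>m\<close> further doublings outweigh \<open>c\<close>; shifting the
    index by \<open>L * m\<close> supplies them.\<close>
  obtain m :: nat where m: "1 / c < 2 ^ m"
    using real_arch_pow[of 2 "1 / c"] by auto
  have bound: "1 / f (c * (2 ^ (n + L * m)) powr \<alpha>) \<le> 1 / f (2 ^ (n div L))" for n
  proof -
    have "real (n div L + m) \<le> real (n div L + m) * (real L * \<alpha>)"
      using L mult_left_mono[of 1 "real L * \<alpha>" "real (n div L + m)"] by simp
    also have "\<dots> = real ((n div L) * L + L * m) * \<alpha>"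
      by (simp add: algebra_simps)
    also have "\<dots> \<le> real (n + L * m) * \<alpha>"
      using \<open>\<alpha> > 0\<close> by (intro mult_right_mono) (auto simp flip: of_nat_mult)
    finally have e: "real (n div L + m) \<le> real (n + L * m) * \<alpha>" .
    have "2 ^ (n div L) \<le> c * 2 ^ (n div L + m)"
      using m \<open>c > 0\<close> by (simp add: field_simps power_add)
    also have "\<dots> = c * 2 powr real (n div L + m)"
      by (simp only: powr_realpow)
    also have "\<dots> \<le> c * 2 powr (real (n + L * m) * \<alpha>)"
      using e \<open>c > 0\<close> by (intro mult_left_mono powr_mono) auto
    also have "\<dots> = c * (2 ^ (n + L * m)) powr \<alpha>"
      by (simp add: powr_realpow[symmetric] powr_powr del: of_nat_add)
    finally have "f (2 ^ (n div L)) \<le> f (c * (2 ^ (n + L * m)) powr \<alpha>)"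
      using \<open>c > 0\<close> by (intro mono_onD[OF f(2)]) auto
    then show ?thesis
      using f(1)[of "2 ^ (n div L)"] by (intro divide_left_mono mult_pos_pos) auto
  qed
  have "summable (\<lambda>n. 1 / f (2 ^ (n div L)))"
    using f(1) \<open>L > 0\<close> by (intro summable_div_nat[OF sum]) (auto simp: less_imp_le)
  then have "summable (\<lambda>n. 1 / f (c * (2 ^ (n + L * m)) powr \<alpha>))"
    by (rule summable_comparison_test'[where N = 0])
       (use bound f(1) \<open>c > 0\<close> in \<open>auto simp: abs_of_pos\<close>)
  then show ?thesis
    by (subst (asm) summable_iff_shift)
qed

text \<open>In Cauchy condensation the weight \<open>2 ^ n\<close> cancels the factor
  \<open>real n\<close> taken at \<open>2 ^ n\<close>, which leaves the series of the preceding
  lemma.\<close>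

lemma summable_inverse_mult_mono_powr:
  fixes f :: "real \<Rightarrow> real"
  assumes f: "\<And>x. x \<ge> 0 \<Longrightarrow> f x > 0" "mono_on {0..} f"
    and sum: "summable (\<lambda>n. 1 / f (2 ^ n))" and "c > 0" "\<alpha> > 0"
  shows "summable (\<lambda>n. 1 / (real n * f (c * real n powr \<alpha>)))"
proof -
  let ?g = "\<lambda>n. 1 / (real n * f (c * real n powr \<alpha>))"
  have "summable ?g \<longleftrightarrow> summable (\<lambda>n. 2 ^ n * ?g (2 ^ n))"
  proof (rule condensation_test)
    \<comment> \<open>Monotonicity holds only from index 1 on: the term at 0 is
      \<open>1 / 0 = 0\<close>.\<close>
    fix m :: nat assume "0 < m"
    have "f (c * real m powr \<alpha>) \<le> f (c * real (Suc m) powr \<alpha>)"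
      using \<open>c > 0\<close> \<open>\<alpha> > 0\<close>
      by (intro mono_onD[OF f(2)] mult_left_mono powr_mono2) auto
    then show "?g (Suc m) \<le> ?g m"
      using \<open>0 < m\<close> f(1)[of "c * real m powr \<alpha>"] f(1)[of "c * real (Suc m) powr \<alpha>"] \<open>c > 0\<close>
      by (intro divide_left_mono mult_mono mult_pos_pos) auto
  next
    fix n show "?g n \<ge> 0"
      using f(1)[of "c * real n powr \<alpha>"] \<open>c > 0\<close> by simp
  qed
  then show ?thesis
    using summable_inverse_mono_geometric[OF f sum \<open>c > 0\<close> \<open>\<alpha> > 0\<close>] by simp
qed

text \<open>Markov's inequality and linearity of expectation, so dependence between the
  \<open>Z i\<close> does not matter. The finite bound on the nonnegative integrals also yields
  integrability.\<close>

lemma (in prob_space) prob_sum_ge_le_nn_integral: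
  fixes Z :: "nat \<Rightarrow> 'a \<Rightarrow> real"
  assumes meas: "\<And>i. i \<in> I \<Longrightarrow> Z i \<in> borel_measurable M"
    and nonneg: "\<And>i \<omega>. i \<in> I \<Longrightarrow> Z i \<omega> \<ge> 0"
    and bound: "\<And>i. i \<in> I \<Longrightarrow> (\<integral>\<^sup>+\<omega>. ennreal (Z i \<omega>) \<partial>M) \<le> ennreal C" and "C \<ge> 0" "t > 0"
  shows "prob {\<omega> \<in> space M. t \<le> (\<Sum>i\<in>I. Z i \<omega>)} \<le> real (card I) * C / t"
proof -
  have int: "integrable M (Z i)" if "i \<in> I" for i
    using meas nonneg that le_less_trans[OF bound[OF that] ennreal_less_top]
    by (intro integrableI_bounded) auto
  have "expectation (Z i) \<le> C" if "i \<in> I" for i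
    using bound[OF that] nonneg that \<open>C \<ge> 0\<close>
    by (subst (asm) nn_integral_eq_integral[OF int[OF that]]) auto
  then have le: "(\<Sum>i\<in>I. expectation (Z i)) \<le> real (card I) * C"
    by (rule sum_bounded_above)
  have "prob {\<omega> \<in> space M. t \<le> (\<Sum>i\<in>I. Z i \<omega>)} \<le> expectation (\<lambda>\<omega>. \<Sum>i\<in>I. Z i \<omega>) / t"
    using int nonneg \<open>t > 0\<close>
    by (intro integral_Markov_inequality_measure[where A = "{}"]) (simp_all add: sum_nonneg)
  also have "expectation (\<lambda>\<omega>. \<Sum>i\<in>I. Z i \<omega>) = (\<Sum>i\<in>I. expectation (Z i))"
    using int by (rule Bochner_Integration.integral_sum)
  also have "\<dots> / t \<le> real (card I) * C / t"
    using le \<open>t > 0\<close> by (intro divide_right_mono) auto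
  finally show ?thesis .
qed

theorem theorem4p1:
  fixes M :: "'a measure" and X :: "nat \<Rightarrow> 'a \<Rightarrow> real"
    and f :: "real \<Rightarrow> real" and p q r :: real
  assumes "prob_space M"
    and "\<And>x. x \<ge> 0 \<Longrightarrow> f x > 0"
    and "mono_on {0..} f"
    and "(\<lambda>n::nat. 1 / f (2 ^ n)) summable_on {1..}"
    and "0 < r" and "r < 1" and "p \<ge> r"
    and "q = max p ((p - r) / (1 - r))"
    and "\<And>n. n \<ge> 1 \<Longrightarrow> X n \<in> borel_measurable M"
    and "(SUP n\<in>{1..}. \<integral>\<^sup>+\<omega>. ennreal (\<bar>X n \<omega>\<bar> powr q * f \<bar>X n \<omega>\<bar>) \<partial>M) < \<infinity>"
  shows "\<forall>\<epsilon>>0. (\<lambda>n::nat. real n powr (p / r - 2) *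
           measure M {\<omega> \<in> space M. max_abs_partial_sum X n \<omega> > \<epsilon> * real n powr (1 / r)})
         summable_on {1..}"
proof (intro allI impI)
  fix \<epsilon> :: real assume "\<epsilon> > 0"
  interpret prob_space M by fact
  note f = assms(2,3)
  define Z where "Z i \<omega> = \<bar>X i \<omega>\<bar> powr q * f \<bar>X i \<omega>\<bar>" for i \<omega>
  \<comment> \<open>The supremum is finite by assumption, so \<open>enn2real\<close> loses
    nothing.\<close>
  define C where "C = enn2real (SUP n\<in>{1..}. \<integral>\<^sup>+\<omega>. ennreal (Z n \<omega>) \<partial>M)"
  define s where "s = min p 1"
  define \<alpha> where "\<alpha> = 1 / r - 1"
  define c where "c = \<epsilon> / 2"
  have "c > 0" "\<alpha> > 0" "C \<ge> 0"
    using \<open>\<epsilon> > 0\<close> \<open>0 < r\<close> \<open>r < 1\<close> by (auto simp: c_def \<alpha>_def C_def field_simps)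
  have s: "0 < s" "s \<le> 1" "s \<le> q"
    using assms(5,7,8) by (auto simp: s_def)
  \<comment> \<open>The two branches of the maximum defining \<open>q\<close> match those of
    \<open>s\<close>: for \<open>p \<le> 1\<close> one has \<open>s = p = q\<close>, otherwise
    \<open>s = 1\<close> and \<open>q = (p - r) / (1 - r)\<close>.\<close>
  have exponent: "s + \<alpha> * q = p / r"
  proof (cases "p \<le> 1")
    case True
    then have "p * (1 - r) \<ge> p - r"
      using \<open>0 < r\<close> by (simp add: algebra_simps mult_left_le)
    then have "q = p"
      using \<open>r < 1\<close> by (simp add: assms(8) field_simps)
    then show ?thesis
      using True \<open>0 < r\<close> by (simp add: s_def \<alpha>_def field_simps)
  next
    case False
    then have "p * (1 - r) \<le> p - r"
      using \<open>0 < r\<close> by (simp add: algebra_simps)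
    then have "q = (p - r) / (1 - r)"
      using \<open>r < 1\<close> by (simp add: assms(8) field_simps)
    then have "q * (1 - r) = p - r"
      using \<open>r < 1\<close> by simp
    then show ?thesis
      using False \<open>0 < r\<close> by (simp add: s_def \<alpha>_def field_simps)
  qed
  have Z_nonneg: "Z i \<omega> \<ge> 0" for i \<omega>
    using f(1)[of "\<bar>X i \<omega>\<bar>"] by (simp add: Z_def)
  have Z_meas: "Z i \<in> borel_measurable M" if "i \<in> {1..n}" for i n
  proof -
    have [measurable]: "X i \<in> borel_measurable M"
      using that assms(9) by auto
    \<comment> \<open>Monotonicity of \<open>f\<close> is known only on the nonnegative reals.
      Extending by the constant \<open>f 0\<close> gives a monotone, hence Borel, function that
      agrees with \<open>f\<close> at absolute values.\<close>
    have "mono (\<lambda>x. f (max 0 x))"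
      by (intro monoI mono_onD[OF f(2)]) auto
    then have [measurable]: "(\<lambda>x. f (max 0 x)) \<in> borel_measurable borel"
      by (rule borel_measurable_mono)
    have "(\<lambda>\<omega>. \<bar>X i \<omega>\<bar> powr q * f (max 0 \<bar>X i \<omega>\<bar>)) \<in> borel_measurable M"
      by measurable
    then show ?thesis
      by (simp add: Z_def[abs_def])
  qed
  have Z_int: "(\<integral>\<^sup>+\<omega>. ennreal (Z i \<omega>) \<partial>M) \<le> ennreal C" if "i \<in> {1..n}" for i n
  proof -
    have "(\<integral>\<^sup>+\<omega>. ennreal (Z i \<omega>) \<partial>M) \<le> (SUP n\<in>{1..}. \<integral>\<^sup>+\<omega>. ennreal (Z n \<omega>) \<partial>M)"
      using that by (intro SUP_upper) auto
    also have "\<dots> = ennreal C"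
      using assms(10) by (simp add: C_def Z_def)
    finally show ?thesis .
  qed
  let ?P = "\<lambda>n. prob {\<omega> \<in> space M. max_abs_partial_sum X n \<omega> > \<epsilon> * real n powr (1 / r)}"
  have bound: "real n powr (p / r - 2) * ?P n
      \<le> C / c powr q * (1 / (real n * f (c * real n powr \<alpha>)))" if "n \<ge> 1" for n
  proof -
    define a where "a = c * real n powr \<alpha>"
    define t where "t = (real n * a) powr s * a powr (q - s) * f a"
    have "a > 0" "f a > 0"
      using \<open>c > 0\<close> that f(1)[of a] by (auto simp: a_def)
    then have "t > 0"
      using that by (simp add: t_def)
    \<comment> \<open>The exponent \<open>\<alpha> = 1 / r - 1\<close> and the constant
      \<open>c = \<epsilon> / 2\<close> are chosen to make this an equality.\<close>
    have level: "\<epsilon> * real n powr (1 / r) = 2 * (real n * a)"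
      using that by (simp add: a_def c_def \<alpha>_def powr_diff)
    have "?P n \<le> prob {\<omega> \<in> space M. t \<le> (\<Sum>i\<in>{1..n}. Z i \<omega>)}"
    proof (intro finite_measure_mono subsetI CollectI conjI)
      show "{\<omega> \<in> space M. t \<le> (\<Sum>i\<in>{1..n}. Z i \<omega>)} \<in> events"
        using Z_meas by measurable
    next
      fix \<omega> assume \<omega>: "\<omega> \<in> {\<omega> \<in> space M. max_abs_partial_sum X n \<omega> > \<epsilon> * real n powr (1 / r)}"
      then show "\<omega> \<in> space M" by simp
      have "2 * (real n * a) < (\<Sum>i=1..n. \<bar>X i \<omega>\<bar>)"
        using \<omega> max_abs_partial_sum_le_sum_abs[OF that, of X \<omega>] unfolding level by simp
      then show "t \<le> (\<Sum>i\<in>{1..n}. Z i \<omega>)"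
        unfolding t_def Z_def
        by (intro weighted_sum_ge_of_sum_abs_gt f s \<open>a > 0\<close>)
    qed
    also have "\<dots> \<le> real (card {1..n}) * C / t"
      using Z_meas Z_int Z_nonneg \<open>C \<ge> 0\<close> \<open>t > 0\<close>
      by (intro prob_sum_ge_le_nn_integral) auto
    finally have "real n powr (p / r - 2) * ?P n \<le> real n powr (p / r - 2) * (real n * C / t)"
      by (intro mult_left_mono) auto
    \<comment> \<open>The powers of \<open>n\<close> in \<open>t\<close> combine to
      \<open>s + \<alpha> * q = p / r\<close>; against \<open>n powr (p / r - 2) * n\<close> only
      \<open>1 / n\<close> survives.\<close>
    also have "t = c powr q * real n powr (p / r) * f a"
    proof -
      have "t = real n powr s * (a powr s * a powr (q - s)) * f a"
        using \<open>a > 0\<close> by (simp add: t_def powr_mult)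
      also have "a powr s * a powr (q - s) = c powr q * real n powr (\<alpha> * q)"
        using \<open>c > 0\<close> by (simp flip: powr_add) (simp add: a_def powr_mult powr_powr)
      finally show ?thesis
        using exponent by (simp add: mult_ac powr_add flip: exponent)
    qed
    also have "real n powr (p / r - 2) * (real n * C / (c powr q * real n powr (p / r) * f a))
        = C / c powr q * (1 / (real n * f a))"
      using that \<open>c > 0\<close> \<open>f a > 0\<close> by (simp add: powr_diff power2_eq_square field_simps)
    finally show ?thesis
      by (simp add: a_def)
  qed
  have "summable (\<lambda>n. 1 / f (2 ^ n))"
  proof -
    \<comment> \<open>The assumed sum starts at 1, whereas \<open>summable\<close> starts at 0:
      reindexing by \<open>Suc\<close> bridges the two, and the single term at 0 is
      harmless.\<close>
    have "(\<lambda>n. 1 / f (2 ^ Suc n)) summable_on UNIV"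
      using assms(4) summable_on_reindex[of Suc UNIV "\<lambda>n. 1 / f (2 ^ n)"]
      by (simp add: o_def image_Suc_lessThan atLeast_Suc_greaterThan greaterThan_0)
    then have "summable (\<lambda>n. 1 / f (2 ^ Suc n))"
      by (rule summable_on_imp_summable)
    then show ?thesis
      by (subst (asm) summable_Suc_iff)
  qed
  then have "summable (\<lambda>n. C / c powr q * (1 / (real n * f (c * real n powr \<alpha>))))"
    by (intro summable_mult summable_inverse_mult_mono_powr f \<open>c > 0\<close> \<open>\<alpha> > 0\<close>)
  then have "summable (\<lambda>n. real n powr (p / r - 2) * ?P n)"
    \<comment> \<open>The comparison starts at 1 because at \<open>n = 0\<close> the maximum is
      unspecified and \<open>bound\<close> says nothing.\<close>
    by (rule summable_comparison_test'[where N = 1]) (use bound in auto)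
  then have "(\<lambda>n. real n powr (p / r - 2) * ?P n) summable_on UNIV"
    by (rule summable_nonneg_imp_summable_on) auto
  then show "(\<lambda>n. real n powr (p / r - 2) * ?P n) summable_on {1..}"
    by (rule summable_on_subset_banach) auto
qed

end
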